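(* Let $s(n)$ be the number of tournament sequences of length $n$. Then $$\log_2 s(n)=\binom{n}{2}-\log_2(n!)+O\big((\log n)^2\big)$$ as $n\to\infty$.
   Context: A tournament sequence of length $n$ is a sequence of positive integers $(t_1,\ldots,t_n)$ with $t_1=1$ and $t_i<t_{i+1}\leq 2t_i$ for $1\leq i<n$. *)

theory Defs
  imports Complex_Main "HOL-Library.Landau_Symbols"
begin

text \<open>Lists are indexed from 0, so the term \<open>t\<^sub>i\<close> of a sequence is \<open>t ! (i - 1)\<close>.\<close>

definition tournament_seqs :: "nat \<Rightarrow> nat list set" where
  "tournament_seqs n = {t. length t = n \<and> (\<forall>i<n. 0 < t ! i) \<and> (0 < n \<longrightarrow> t ! 0 = 1) \<and>
     (\<forall>i. Suc i < n \<longrightarrow> t ! i < t ! Suc i \<and> t ! Suc i \<le> 2 * t ! i)}"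

definition num_tournament_seqs :: "nat \<Rightarrow> nat" where
  "num_tournament_seqs n = card (tournament_seqs n)"

lemma tournament_seqs_nth_le:
  assumes "t \<in> tournament_seqs n" "i < n"
  shows "t ! i \<le> 2 ^ i"
  using assms(2)
proof (induction i)
  case 0
  then show ?case using assms(1) by (simp add: tournament_seqs_def)
next
  case (Suc i)
  then have "t ! Suc i \<le> 2 * t ! i" "t ! i \<le> 2 ^ i"
    using assms(1) by (auto simp: tournament_seqs_def)
  then show ?case by simp
qed

lemma finite_tournament_seqs: "finite (tournament_seqs n)"
proof (rule finite_subset)
  show "tournament_seqs n \<subseteq> {t. set t \<subseteq> {..2 ^ n} \<and> length t = n}"
  proof (intro subsetI CollectI conjI)
    fix t x assume t: "t \<in> tournament_seqs n" and "x \<in> set t"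
    then obtain i where i: "i < n" "x = t ! i"
      by (auto simp: tournament_seqs_def in_set_conv_nth)
    have "x \<le> 2 ^ i" using tournament_seqs_nth_le[OF t i(1)] i(2) by simp
    also have "\<dots> \<le> 2 ^ n" using i(1) by (simp add: power_increasing)
    finally show "x \<in> {..2 ^ n}" by simp
  qed (simp add: tournament_seqs_def)
  show "finite {t. set t \<subseteq> {..2 ^ n :: nat} \<and> length t = n}"
    by (rule finite_lists_length_eq) simp
qed

end

theory Submission
  imports Defs "HOL-Library.Log_Nat" "HOL-Analysis.Infinite_Products"
begin

text \<open>
  Let \<open>S k a\<close> be the number of ways to continue a tournament sequence by \<open>k\<close> terms after a term
  \<open>a\<close>; then \<open>S (k + 1) a\<close> is the sum of \<open>S k b\<close> over \<open>a < b \<le> 2 a\<close>. Comparing power sums with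
  \<open>x ^ (k + 1) / (k + 1)\<close> at the end points gives, by induction,
  \<open>a ^ k * (\<Prod>i=1..k. (2 ^ i - 1) / i) \<le> S k a \<le> (a + 1) ^ k * (\<Prod>i=1..k. 2 ^ i / i)\<close>.
  At \<open>a = 1\<close> the lower bound is sharp enough, as the product of all \<open>1 - 1 / 2 ^ i\<close> is positive,
  but the upper bound loses a factor \<open>2 ^ k\<close>. This loss disappears when the first
  \<open>j \<approx> log 2 n\<close> steps are estimated trivially (at most \<open>2 ^ (i - 1)\<close> choices at step \<open>i\<close>) and the
  upper bound is used from \<open>a = 2 ^ j \<ge> n\<close> on. The price is a factor
  \<open>n! / (n - j - 1)! \<le> n ^ (j + 1)\<close>, which accounts for the error term.
\<close>

lemma power_Suc_ge_tangent:
  fixes x y :: "'a::linordered_idom"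
  assumes "0 \<le> x" "0 \<le> y"
  shows "x ^ Suc n + of_nat (Suc n) * x ^ n * (y - x) \<le> y ^ Suc n"
proof (induction n)
  case (Suc n)
  have "x ^ Suc (Suc n) + of_nat (Suc (Suc n)) * x ^ Suc n * (y - x)
      \<le> x ^ Suc (Suc n) + of_nat (Suc (Suc n)) * x ^ Suc n * (y - x)
        + of_nat (Suc n) * x ^ n * (y - x)\<^sup>2"
    using \<open>0 \<le> x\<close> by simp
  also have "\<dots> = (x ^ Suc n + of_nat (Suc n) * x ^ n * (y - x)) * y"
    by (simp add: algebra_simps power2_eq_square)
  also have "\<dots> \<le> y ^ Suc n * y"
    by (rule mult_right_mono[OF Suc \<open>0 \<le> y\<close>])
  finally show ?case by (simp only: power_Suc2)
qed simp

lemma power_diff_le_sum_power: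
  fixes x :: "'a::linordered_idom"
  assumes "0 \<le> x" "m \<le> n"
  shows "(of_nat n + x) ^ Suc k - (of_nat m + x) ^ Suc k
           \<le> of_nat (Suc k) * (\<Sum>b\<in>{m<..n}. (of_nat b + x) ^ k)"
proof -
  have "(of_nat n + x) ^ Suc k - (of_nat m + x) ^ Suc k
      = (\<Sum>b\<in>{m<..n}. (of_nat b + x) ^ Suc k - (of_nat (b - 1) + x) ^ Suc k)"
    using sum_telescope''[OF \<open>m \<le> n\<close>, of "\<lambda>b. (of_nat b + x) ^ Suc k"]
    by (simp only: atLeastSucAtMost_greaterThanAtMost)
  also have "\<dots> \<le> (\<Sum>b\<in>{m<..n}. of_nat (Suc k) * (of_nat b + x) ^ k)"
  proof (rule sum_mono)
    fix b assume "b \<in> {m<..n}"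
    then obtain c where b: "b = Suc c" by (cases b) auto
    show "(of_nat b + x) ^ Suc k - (of_nat (b - 1) + x) ^ Suc k
        \<le> of_nat (Suc k) * (of_nat b + x) ^ k"
      using power_Suc_ge_tangent[of "of_nat b + x" "of_nat c + x" k] \<open>0 \<le> x\<close>
      by (simp add: b algebra_simps del: power_Suc)
  qed
  finally show ?thesis by (simp only: sum_distrib_left)
qed

lemma sum_power_le_power_diff:
  fixes x :: "'a::linordered_idom"
  assumes "0 \<le> x" "m \<le> n"
  shows "of_nat (Suc k) * (\<Sum>b\<in>{m<..n}. (of_nat b + x) ^ k)
           \<le> (of_nat n + x + 1) ^ Suc k - (of_nat m + x + 1) ^ Suc k"
proof -
  have "(\<Sum>b\<in>{m<..n}. of_nat (Suc k) * (of_nat b + x) ^ k)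
      \<le> (\<Sum>b\<in>{m<..n}. (of_nat b + x + 1) ^ Suc k - (of_nat (b - 1) + x + 1) ^ Suc k)"
  proof (rule sum_mono)
    fix b assume "b \<in> {m<..n}"
    then obtain c where b: "b = Suc c" by (cases b) auto
    show "of_nat (Suc k) * (of_nat b + x) ^ k
        \<le> (of_nat b + x + 1) ^ Suc k - (of_nat (b - 1) + x + 1) ^ Suc k"
      using power_Suc_ge_tangent[of "of_nat b + x" "of_nat b + x + 1" k] \<open>0 \<le> x\<close>
      by (simp add: b algebra_simps del: power_Suc)
  qed
  also have "\<dots> = (of_nat n + x + 1) ^ Suc k - (of_nat m + x + 1) ^ Suc k"
    using sum_telescope''[OF \<open>m \<le> n\<close>, of "\<lambda>b. (of_nat b + x + 1) ^ Suc k"]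
    by (simp only: atLeastSucAtMost_greaterThanAtMost)
  finally show ?thesis by (simp only: sum_distrib_left)
qed

lemma choose_two_Suc: "Suc n choose 2 = n + (n choose 2)"
  by (simp add: numeral_2_eq_2)

lemma choose_two_add: "(m + n) choose 2 = (m choose 2) + (n choose 2) + m * n"
  by (induction m) (simp_all add: choose_two_Suc binomial_eq_0)

lemma prod_power_two_div: "(\<Prod>i=1..k. 2 ^ i / real i) = 2 ^ (Suc k choose 2) / fact k"
  by (induction k) (simp_all add: choose_two_Suc[of "Suc _"] power_add binomial_eq_0 mult_ac)

lemma prod_one_minus_half_power_ge: "1 / 4 \<le> (\<Prod>i=1..k. 1 - 1 / 2 ^ i :: real)"
proof (cases k)
  case (Suc m)
  have "(\<Sum>i=2..k. 1 / 2 ^ i :: real) = 1 / 2 - 1 / 2 ^ k"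
    unfolding Suc by (induction m) simp_all
  then have "1 / 2 \<le> 1 - (\<Sum>i=2..k. 1 / 2 ^ i :: real)" by simp
  also have "\<dots> \<le> (\<Prod>i=2..k. 1 - 1 / 2 ^ i)"
    by (rule Weierstrass_prod_ineq) (simp add: one_le_power)
  finally have "1 / 2 \<le> (\<Prod>i=2..k. 1 - 1 / 2 ^ i :: real)" .
  moreover have "(\<Prod>i=1..k. 1 - 1 / 2 ^ i :: real) = 1 / 2 * (\<Prod>i=2..k. 1 - 1 / 2 ^ i)"
    by (subst prod.atLeast_Suc_atMost) (simp_all add: Suc numeral_2_eq_2)
  ultimately show ?thesis by simp
qed simp

lemma prod_power_two_minus_one_div_ge:
  "2 ^ (Suc k choose 2) / (4 * fact k) \<le> (\<Prod>i=1..k. (2 ^ i - 1) / real i)"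
proof -
  have "2 ^ (Suc k choose 2) / (4 * fact k) = (\<Prod>i=1..k. 2 ^ i / real i) * (1 / 4)"
    unfolding prod_power_two_div by simp
  also have "\<dots> \<le> (\<Prod>i=1..k. 2 ^ i / real i) * (\<Prod>i=1..k. 1 - 1 / 2 ^ i)"
    by (intro mult_left_mono prod_one_minus_half_power_ge prod_nonneg) simp
  also have "\<dots> = (\<Prod>i=1..k. (2 ^ i - 1) / real i)"
    unfolding prod.distrib[symmetric]
    by (intro prod.cong refl) (simp add: right_diff_distrib diff_divide_distrib)
  finally show ?thesis .
qed

lemma fact_le_power_mult_fact:
  assumes "k \<le> n"
  shows "fact n \<le> n ^ (n - k) * (fact k :: nat)"
proof -
  have "fact n = (n choose (n - k)) * fact (n - k) * (fact k :: nat)"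
    using binomial_fact_lemma[of "n - k" n] assms by (simp add: mult_ac)
  also have "\<dots> \<le> n ^ (n - k) * fact k"
    by (rule mult_right_mono[OF binomial_fact_pow]) simp
  finally show ?thesis .
qed

lemma power_add_one_le_exp_mult_power:
  assumes "k \<le> m"
  shows "(real m + 1) ^ k \<le> exp 1 * real m ^ k"
proof (cases "m = 0")
  case False
  have "(real m + 1) ^ k = (1 + 1 / real m) ^ k * real m ^ k"
    using False by (simp add: field_simps flip: power_mult_distrib)
  also have "\<dots> \<le> (1 + 1 / real m) ^ m * real m ^ k"
    using assms by (intro mult_right_mono power_increasing) auto
  also have "\<dots> \<le> exp 1 * real m ^ k"
    using False by (intro mult_right_mono exp_ge_one_plus_x_over_n_power_n) auto
  finally show ?thesis .
qed (use assms in simp)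

definition continuations :: "nat \<Rightarrow> nat \<Rightarrow> nat list set" where
  "continuations k a = {t. length t = k \<and> successively (\<lambda>x y. x < y \<and> y \<le> 2 * x) (a # t)}"

definition num_continuations :: "nat \<Rightarrow> nat \<Rightarrow> nat" where
  "num_continuations k a = card (continuations k a)"

lemma continuations_0: "continuations 0 a = {[]}"
  by (auto simp: continuations_def)

lemma continuations_Suc:
  "continuations (Suc k) a = (\<Union>b\<in>{a<..2 * a}. (#) b ` continuations k b)"
  by (auto simp: continuations_def length_Suc_conv)

lemma finite_continuations: "finite (continuations k a)"
  by (induction k arbitrary: a) (simp_all add: continuations_0 continuations_Suc)

lemma num_continuations_0 [simp]: "num_continuations 0 a = 1"
  by (simp add: num_continuations_def continuations_0)

lemma num_continuations_Suc:
  "num_continuations (Suc k) a = (\<Sum>b\<in>{a<..2 * a}. num_continuations k b)"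
proof -
  have "num_continuations (Suc k) a = (\<Sum>b\<in>{a<..2 * a}. card ((#) b ` continuations k b))"
    unfolding num_continuations_def continuations_Suc
    by (rule card_UN_disjoint) (auto simp: finite_continuations)
  then show ?thesis by (simp add: card_image num_continuations_def)
qed

lemma tournament_seqs_Suc: "tournament_seqs (Suc n) = (#) 1 ` continuations n 1"
proof (intro set_eqI)
  fix t :: "nat list"
  show "t \<in> tournament_seqs (Suc n) \<longleftrightarrow> t \<in> (#) 1 ` continuations n 1"
  proof (cases t)
    case (Cons a u)
    have "\<forall>i<n. 0 < u ! i" if "\<forall>i<n. (1 # u) ! i < u ! i"
      using that by (metis less_zeroE not_gr_zero)
    then show ?thesis
      by (auto simp: Cons tournament_seqs_def continuations_def successively_conv_nth
            All_less_Suc2 image_iff)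
  qed (auto simp: tournament_seqs_def)
qed

lemma num_tournament_seqs_0: "num_tournament_seqs 0 = 1"
  by (simp add: num_tournament_seqs_def tournament_seqs_def)

lemma num_tournament_seqs_Suc: "num_tournament_seqs (Suc n) = num_continuations n 1"
  by (simp add: num_tournament_seqs_def tournament_seqs_Suc card_image num_continuations_def)

lemma mono_num_continuations: "mono (num_continuations k)"
proof (induction k)
  case (Suc k)
  show ?case
  proof (rule monoI)
    fix a a' :: nat assume "a \<le> a'"
    then obtain d where a': "a' = a + d" using le_Suc_ex by blast
    have "num_continuations (Suc k) a \<le> (\<Sum>b\<in>{a<..2 * a}. num_continuations k (b + d))"
      unfolding num_continuations_Suc by (intro sum_mono monoD[OF Suc]) simp
    also have "\<dots> = (\<Sum>b\<in>(\<lambda>b. b + d) ` {a<..2 * a}. num_continuations k b)"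
      by (simp add: sum.reindex)
    also have "\<dots> \<le> num_continuations (Suc k) a'"
      unfolding num_continuations_Suc a' by (rule sum_mono2) auto
    finally show "num_continuations (Suc k) a \<le> num_continuations (Suc k) a'" .
  qed
qed (simp add: monoI)

lemma num_continuations_add_le:
  "num_continuations (j + k) a \<le> a ^ j * 2 ^ (j choose 2) * num_continuations k (2 ^ j * a)"
proof (induction j arbitrary: a)
  case (Suc j)
  define B where "B = (2 * a) ^ j * 2 ^ (j choose 2) * num_continuations k (2 ^ j * (2 * a))"
  have "num_continuations (Suc j + k) a = (\<Sum>b\<in>{a<..2 * a}. num_continuations (j + k) b)"
    by (simp add: num_continuations_Suc)
  also have "\<dots> \<le> (\<Sum>b\<in>{a<..2 * a}. B)"
  proof (rule sum_mono)
    fix b assume "b \<in> {a<..2 * a}"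
    then have "b ^ j * 2 ^ (j choose 2) * num_continuations k (2 ^ j * b) \<le> B"
      unfolding B_def by (intro mult_mono power_mono monoD[OF mono_num_continuations]) auto
    with Suc show "num_continuations (j + k) b \<le> B" by (rule order_trans)
  qed
  also have "\<dots> = a * B" by simp
  also have "\<dots> = a ^ Suc j * 2 ^ (Suc j choose 2) * num_continuations k (2 ^ Suc j * a)"
    by (simp add: B_def choose_two_Suc power_mult_distrib power_add mult_ac)
  finally show ?case .
qed (simp add: binomial_eq_0)

lemma num_continuations_ge:
  "real a ^ k * (\<Prod>i=1..k. (2 ^ i - 1) / real i) \<le> real (num_continuations k a)"
proof (induction k arbitrary: a)
  case (Suc k)
  define c :: real where "c = (\<Prod>i=1..k. (2 ^ i - 1) / real i)"
  have "0 \<le> c" unfolding c_def by (intro prod_nonneg) (simp add: one_le_power)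
  have "real a ^ Suc k * (\<Prod>i=1..Suc k. (2 ^ i - 1) / real i)
      = c / real (Suc k) * (real (2 * a) ^ Suc k - real a ^ Suc k)"
    by (simp add: c_def power_mult_distrib algebra_simps diff_divide_distrib
          del: power_Suc of_nat_Suc)
  also have "\<dots> \<le> c / real (Suc k) * (real (Suc k) * (\<Sum>b\<in>{a<..2 * a}. real b ^ k))"
    using power_diff_le_sum_power[of 0 a "2 * a" k] \<open>0 \<le> c\<close>
    by (intro mult_left_mono) (simp_all del: power_Suc of_nat_Suc)
  also have "\<dots> = (\<Sum>b\<in>{a<..2 * a}. real b ^ k * c)"
    by (simp add: sum_distrib_left mult.commute del: of_nat_Suc)
  also have "\<dots> \<le> (\<Sum>b\<in>{a<..2 * a}. real (num_continuations k b))"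
    unfolding c_def by (intro sum_mono Suc)
  finally show ?case by (simp only: num_continuations_Suc of_nat_sum)
qed simp

lemma num_continuations_le:
  "real (num_continuations k a) \<le> (real a + 1) ^ k * (\<Prod>i=1..k. 2 ^ i / real i)"
proof (induction k arbitrary: a)
  case (Suc k)
  define c :: real where "c = (\<Prod>i=1..k. 2 ^ i / real i)"
  have "0 \<le> c" unfolding c_def by (intro prod_nonneg) simp
  have "real (num_continuations (Suc k) a) \<le> (\<Sum>b\<in>{a<..2 * a}. (real b + 1) ^ k * c)"
    unfolding c_def num_continuations_Suc of_nat_sum by (intro sum_mono Suc)
  also have "\<dots> = c / real (Suc k) * (real (Suc k) * (\<Sum>b\<in>{a<..2 * a}. (real b + 1) ^ k))"
    by (simp add: sum_distrib_left mult.commute del: of_nat_Suc)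
  also have "\<dots> \<le> c / real (Suc k) * (2 * (real a + 1)) ^ Suc k"
  proof (intro mult_left_mono)
    have "real (Suc k) * (\<Sum>b\<in>{a<..2 * a}. (real b + 1) ^ k)
        \<le> (real (2 * a) + 1 + 1) ^ Suc k - (real a + 1 + 1) ^ Suc k"
      by (rule sum_power_le_power_diff) auto
    also have "\<dots> \<le> (real (2 * a) + 1 + 1) ^ Suc k" by simp
    also have "real (2 * a) + 1 + 1 = 2 * (real a + 1)" by simp
    finally show "real (Suc k) * (\<Sum>b\<in>{a<..2 * a}. (real b + 1) ^ k) \<le> (2 * (real a + 1)) ^ Suc k" .
  qed (use \<open>0 \<le> c\<close> in simp)
  also have "\<dots> = (real a + 1) ^ Suc k * (\<Prod>i=1..Suc k. 2 ^ i / real i)"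
    unfolding power_mult_distrib by (simp add: c_def mult_ac del: power_Suc of_nat_Suc)
  finally show ?case .
qed simp

lemma num_tournament_seqs_ge: "2 ^ (n choose 2) / (4 * fact n) \<le> real (num_tournament_seqs n)"
proof (cases n)
  case (Suc k)
  have "2 ^ (n choose 2) / (4 * fact n) \<le> (2 ^ (n choose 2) / (4 * fact k) :: real)"
    by (intro divide_left_mono mult_left_mono fact_mono) (simp_all add: Suc)
  also have "\<dots> \<le> (\<Prod>i=1..k. (2 ^ i - 1) / real i)"
    unfolding Suc by (rule prod_power_two_minus_one_div_ge)
  also have "\<dots> \<le> real (num_tournament_seqs n)"
    using num_continuations_ge[of 1 k] by (simp add: Suc num_tournament_seqs_Suc)
  finally show ?thesis .
qed (simp add: num_tournament_seqs_0 binomial_eq_0)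

lemma num_tournament_seqs_le:
  assumes "j < n" "n \<le> 2 ^ j"
  shows "real (num_tournament_seqs n) \<le> 4 * real n ^ Suc j * 2 ^ (n choose 2) / fact n"
proof -
  define k where "k = n - Suc j"
  have n: "n = Suc k + j" using assms by (simp add: k_def)
  have choose_two_n: "n choose 2 = (j choose 2) + j * k + j + (Suc k choose 2)"
    unfolding n choose_two_add by simp
  have "real (fact n) \<le> real (n ^ (n - k) * fact k)"
    by (intro of_nat_mono fact_le_power_mult_fact) (simp add: n)
  then have inverse_fact_le: "1 / fact k \<le> real n ^ Suc j / (fact n :: real)"
    by (simp add: n field_simps del: fact_Suc)
  have "(2 ^ j + 1) ^ k \<le> exp 1 * (2 ^ j :: real) ^ k"
    using power_add_one_le_exp_mult_power[of k "2 ^ j"] assms n by simp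
  also have "\<dots> \<le> 4 * 2 ^ (j * k)"
    using exp_le by (simp add: power_mult)
  finally have power_le: "(2 ^ j + 1) ^ k \<le> (4 * 2 ^ (j * k) :: real)" .
  have "num_tournament_seqs n \<le> 2 ^ (j choose 2) * num_continuations k (2 ^ j)"
    using num_continuations_add_le[of j k 1] by (simp add: n num_tournament_seqs_Suc add.commute)
  then have "real (num_tournament_seqs n)
      \<le> 2 ^ (j choose 2) * real (num_continuations k (2 ^ j))"
    by (metis of_nat_le_iff of_nat_mult of_nat_numeral of_nat_power)
  also have "\<dots> \<le> 2 ^ (j choose 2) * ((2 ^ j + 1) ^ k * (2 ^ (Suc k choose 2) / fact k))"
    using num_continuations_le[of k "2 ^ j"] unfolding prod_power_two_div
    by (intro mult_left_mono) simp_all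
  also have "\<dots> \<le> 2 ^ (j choose 2) * (4 * 2 ^ (j * k) * (2 ^ (Suc k choose 2) / fact k))"
    by (intro mult_left_mono mult_right_mono power_le) auto
  also have "\<dots> = 4 * 2 ^ ((j choose 2) + j * k + (Suc k choose 2)) * (1 / fact k)"
    by (simp add: power_add)
  also have "\<dots> \<le> 4 * 2 ^ (n choose 2) * (real n ^ Suc j / fact n)"
    unfolding choose_two_n by (intro mult_mono inverse_fact_le mult_left_mono power_increasing) auto
  finally show ?thesis by (simp add: mult_ac)
qed

lemma log_num_tournament_seqs_ge:
  "real (n choose 2) - log 2 (fact n) - 2 \<le> log 2 (real (num_tournament_seqs n))"
proof -
  have "log 2 (2 ^ (n choose 2) / (4 * fact n)) \<le> log 2 (real (num_tournament_seqs n))"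
    using num_tournament_seqs_ge by (rule log_mono[rotated 2]) auto
  moreover have "log 2 4 = (2::real)"
    using log_pow_cancel[of 2 2] by simp
  ultimately show ?thesis
    by (simp add: log_divide log_mult log_nat_power)
qed

lemma log_num_tournament_seqs_le:
  assumes "2 \<le> n"
  shows "log 2 (real (num_tournament_seqs n))
           \<le> real (n choose 2) - log 2 (fact n) + 2 + (log 2 (real n) + 2) * log 2 (real n)"
proof -
  define j where "j = ceillog2 n"
  have "n \<le> 2 ^ (n - 1)"
    using less_exp[of "n - 1"] by linarith
  then have "j < n"
    using assms ceillog2_le_iff[of n "n - 1"] by (simp add: j_def)
  have "0 < (2 ^ (n choose 2) / (4 * fact n) :: real)" by simp
  also have "\<dots> \<le> real (num_tournament_seqs n)" by (rule num_tournament_seqs_ge)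
  finally have "log 2 (real (num_tournament_seqs n))
      \<le> log 2 (4 * real n ^ Suc j * 2 ^ (n choose 2) / fact n)"
    using num_tournament_seqs_le[OF \<open>j < n\<close>] le_two_power_ceillog2
    by (intro log_mono) (auto simp: j_def)
  also have "\<dots> = real (n choose 2) - log 2 (fact n) + 2 + real (Suc j) * log 2 (real n)"
    using assms log_pow_cancel[of 2 2]
    by (simp add: log_divide log_mult log_nat_power del: power_Suc)
  also have "real (Suc j) * log 2 (real n) \<le> (log 2 (real n) + 2) * log 2 (real n)"
    using assms ceillog2_less_log[of n] by (intro mult_right_mono) (auto simp: j_def)
  finally show ?thesis by simp
qed

lemma abs_log_num_tournament_seqs_diff_le:
  assumes "2 \<le> n"
  shows "\<bar>log 2 (real (num_tournament_seqs n)) - (real (n choose 2) - log 2 (fact n))\<bar>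
           \<le> 5 * (log 2 (real n))\<^sup>2"
proof -
  define L where "L = log 2 (real n)"
  have "1 \<le> L" using assms by (simp add: L_def)
  then have "1 \<le> L\<^sup>2" "L \<le> L\<^sup>2"
    by (auto simp: self_le_power one_le_power)
  then have "2 + (L + 2) * L \<le> 5 * L\<^sup>2"
    by (simp add: power2_eq_square algebra_simps)
  with \<open>1 \<le> L\<^sup>2\<close> show ?thesis
    using log_num_tournament_seqs_ge[of n] log_num_tournament_seqs_le[OF assms]
    unfolding L_def by linarith
qed

theorem theorem3:
  shows "(\<lambda>n::nat. log 2 (real (num_tournament_seqs n))
            - (real (n choose 2) - log 2 (fact n))) \<in> O(\<lambda>n. (ln (real n))\<^sup>2)"
proof (rule bigoI)
  show "\<forall>\<^sub>F n in at_top. norm (log 2 (real (num_tournament_seqs n))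
      - (real (n choose 2) - log 2 (fact n))) \<le> 5 / (ln 2)\<^sup>2 * norm ((ln (real n))\<^sup>2)"
    using eventually_ge_at_top[of 2]
  proof eventually_elim
    case (elim n)
    have "5 * (log 2 (real n))\<^sup>2 = 5 / (ln 2)\<^sup>2 * (ln (real n))\<^sup>2"
      by (simp add: log_def power_divide)
    with abs_log_num_tournament_seqs_diff_le[OF elim] show ?case by simp
  qed
qed

end
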